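(* Let $\mathcal H$ be a real Hilbert space, let $f\in\Gamma_0(\mathcal H)$ and suppose $\operatorname{int}\operatorname{dom} f\neq\varnothing$. Then the following are equivalent: (i) $\partial f$ is at most single-valued. (ii) $f$ is Gâteaux differentiable on the open convex set $\operatorname{int}\operatorname{dom} f$, and $\partial f(x)=\varnothing$ for every $x\in\mathcal H\setminus(\operatorname{int}\operatorname{dom} f)$. (iii) $f$ is Gâteaux differentiable on the open convex set $\operatorname{int}\operatorname{dom} f$, and $\lim_{i\to\infty}\|\nabla f(x_i)\|=+\infty$ whenever $(x_i)_{i\in\mathbb N}$ is a sequence in $\operatorname{int}\operatorname{dom} f$ converging (in norm) to a boundary point of $\operatorname{int}\operatorname{dom} f$.
   Context: $\Gamma_0(\mathcal H)$ is the set of proper, lower semicontinuous, convex functions $f:\mathcal H\to\left]-\infty,+\infty\right]$; $\operatorname{dom} f=\{x: f(x)<+\infty\}$. The subdifferential is $\partial f(x)=\{v\in\mathcal H : f(y)\ge f(x)+\langle v,y-x\rangle\ \forall y\in\mathcal H\}$. $\partial f$ is at most single-valued if $\partial f(x)$ is either empty or a singleton for every $x\in\mathcal H$. $\nabla f$ denotes the Gâteaux gradient. *)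

theory Defs
  imports "HOL-Analysis.Analysis"
begin

text \<open>
  A real Hilbert space is a type of class \<open>{real_inner, complete_space}\<close>. Functions with
  values in \<open>]-\<infinity>, +\<infinity>]\<close> are functions into \<open>ereal\<close> for which \<open>-\<infinity>\<close> is excluded by properness.
\<close>

definition edom :: "('a \<Rightarrow> ereal) \<Rightarrow> 'a set"
  where "edom f = {x. f x < \<infinity>}"

definition proper_fun :: "('a \<Rightarrow> ereal) \<Rightarrow> bool"
  where "proper_fun f \<longleftrightarrow> (\<forall>x. f x \<noteq> -\<infinity>) \<and> edom f \<noteq> {}"

definition lower_semicontinuous :: "('a::topological_space \<Rightarrow> ereal) \<Rightarrow> bool"
  where "lower_semicontinuous f \<longleftrightarrow> (\<forall>x. f x \<le> Liminf (at x) f)"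

text \<open>The library's \<open>convex_on\<close> needs values in a real vector space, so it does not apply to
  \<open>ereal\<close>. The inequality below is only used for functions that never take the value \<open>-\<infinity>\<close>, so
  no sum \<open>\<infinity> + -\<infinity>\<close> arises.\<close>

definition convex_fun :: "('a::real_vector \<Rightarrow> ereal) \<Rightarrow> bool"
  where "convex_fun f \<longleftrightarrow>
    (\<forall>x y. \<forall>u::real. 0 < u \<and> u < 1 \<longrightarrow>
       f (u *\<^sub>R x + (1 - u) *\<^sub>R y) \<le> ereal u * f x + ereal (1 - u) * f y)"

definition Gamma0 :: "('a::real_normed_vector \<Rightarrow> ereal) set"
  where "Gamma0 = {f. proper_fun f \<and> lower_semicontinuous f \<and> convex_fun f}"

definition subdifferential :: "('a::real_inner \<Rightarrow> ereal) \<Rightarrow> 'a \<Rightarrow> 'a set"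
  where "subdifferential f x = {v. \<forall>y. f y \<ge> f x + ereal (v \<bullet> (y - x))}"

definition at_most_single_valued :: "('a \<Rightarrow> 'b set) \<Rightarrow> bool"
  where "at_most_single_valued A \<longleftrightarrow> (\<forall>x. A x = {} \<or> (\<exists>v. A x = {v}))"

text \<open>The difference quotient is formed in \<open>ereal\<close>; since \<open>f x\<close> is required to be finite,
  no difference of infinities arises for \<open>f\<close> not taking the value \<open>-\<infinity>\<close>.\<close>

definition has_gateaux_derivative ::
    "('a::real_normed_vector \<Rightarrow> ereal) \<Rightarrow> ('a \<Rightarrow> real) \<Rightarrow> 'a \<Rightarrow> bool"
  where "has_gateaux_derivative f L x \<longleftrightarrow>
    \<bar>f x\<bar> \<noteq> \<infinity> \<and> bounded_linear L \<and>
    (\<forall>h. ((\<lambda>t::real. (f (x + t *\<^sub>R h) - f x) / ereal t) \<longlongrightarrow> ereal (L h)) (at 0))"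

definition gateaux_differentiable_on ::
    "('a::real_normed_vector \<Rightarrow> ereal) \<Rightarrow> 'a set \<Rightarrow> bool"
  where "gateaux_differentiable_on f S \<longleftrightarrow> (\<forall>x\<in>S. \<exists>L. has_gateaux_derivative f L x)"

text \<open>The gradient is the Riesz representative of the Gateaux derivative; the value is
  meaningful only where \<open>f\<close> is Gateaux differentiable.\<close>

definition gateaux_gradient :: "('a::real_inner \<Rightarrow> ereal) \<Rightarrow> 'a \<Rightarrow> 'a"
  where "gateaux_gradient f x = (THE v. has_gateaux_derivative f (\<lambda>h. v \<bullet> h) x)"

lemma convex_edom:
  assumes "convex_fun f"
  shows "convex (edom f)"
proof (rule convexI)
  fix x y :: 'a and u v :: real
  assume xy: "x \<in> edom f" "y \<in> edom f" and uv: "0 \<le> u" "0 \<le> v" "u + v = 1"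
  show "u *\<^sub>R x + v *\<^sub>R y \<in> edom f"
  proof (cases "u = 0 \<or> v = 0")
    case True
    then show ?thesis using xy uv by auto
  next
    case False
    then have u: "0 < u" "u < 1" and v: "v = 1 - u" using uv by auto
    have "f (u *\<^sub>R x + v *\<^sub>R y) \<le> ereal u * f x + ereal (1 - u) * f y"
      using assms u unfolding convex_fun_def v by blast
    also have "\<dots> < \<infinity>"
      using xy u unfolding edom_def by (cases "f x"; cases "f y") auto
    finally show ?thesis by (simp add: edom_def)
  qed
qed

lemma open_convex_interior_edom:
  fixes f :: "'a::real_normed_vector \<Rightarrow> ereal"
  assumes "f \<in> Gamma0"
  shows "open (interior (edom f)) \<and> convex (interior (edom f))"
  using assms by (auto simp: Gamma0_def intro: convex_interior convex_edom)

end

theory Submission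
  imports Defs
begin

text \<open>
  Everything rests on one separation result: a point outside the closure of a convex cone in a
  Hilbert space is separated from the cone by a hyperplane, by projecting onto the closure.

  Write \<open>D\<close> for the interior of the domain. At \<open>x \<in> D\<close> the function is locally bounded above, by
  the Baire category theorem, so separating \<open>(h, c)\<close> from the cone of all \<open>(k, s)\<close> with
  \<open>f (x + t k) \<le> f x + t s\<close> for some \<open>t > 0\<close> shows that the directional derivative at \<open>x\<close> is the
  supremum of the subgradients; a unique subgradient is therefore a Gateaux gradient. At
  \<open>x \<notin> D\<close> in the domain there is a nonzero normal vector \<open>w\<close>, and a subgradient \<open>v\<close> would give
  another one, \<open>v + w\<close>.

  If gradients stay bounded along a sequence tending to a boundary point, any vector common to the
  closed convex hulls of their tails is a subgradient at that point; this replaces weak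
  compactness. Conversely, if \<open>x \<notin> D\<close> has a subgradient, then the gradients on the segment from
  a point of \<open>D\<close> to \<open>x\<close> are bounded, by monotonicity and the upper bound of \<open>f\<close> near that point.
\<close>

section \<open>Least-norm points and separation from cones\<close>

text \<open>A constant sequence gives the projection onto a closed convex set; a decreasing one
  gives a common point of bounded tails. The least norms \<open>d n\<close> increase to a finite
  limit, so by the parallelogram law near-minimisers form a Cauchy sequence.\<close>

lemma nested_convex_min_norm:
  fixes C :: "nat \<Rightarrow> 'b::{real_inner, complete_space} set"
  assumes cl: "\<And>n. closed (C n)" and cv: "\<And>n. convex (C n)"
    and ne: "\<And>n. C n \<noteq> {}" and dec: "decseq C"
    and bd: "\<And>n. \<exists>y\<in>C n. norm y \<le> B"
  obtains x where "x \<in> (\<Inter>n. C n)" "\<And>y. y \<in> (\<Inter>n. C n) \<Longrightarrow> norm x \<le> norm y"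
proof -
  define d where "d n = (INF y\<in>C n. norm y)" for n
  have bb: "bdd_below (norm ` C n)" for n
    by (rule bdd_belowI[of _ 0]) auto
  have d_le: "d n \<le> norm y" if "y \<in> C n" for n y
    unfolding d_def by (rule cINF_lower[OF bb that])
  have d0: "0 \<le> d n" for n
    unfolding d_def using ne by (intro cINF_greatest) auto
  have sub: "C m \<subseteq> C n" if "n \<le> m" for n m
    using dec that by (auto simp: decseq_def)
  have inc: "incseq d"
    unfolding incseq_def d_def by (intro allI impI cINF_superset_mono[OF ne bb sub]) auto
  have "bdd_above (range d)"
    using bd d_le by (intro bdd_aboveI[of _ B]) (force intro: order_trans)
  then obtain D where D: "d \<longlonglongrightarrow> D" and dD: "\<And>n. d n \<le> D"
    using inc by (metis LIMSEQ_incseq_SUP incseq_le)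
  have "\<exists>y\<in>C n. norm y < d n + inverse (real (Suc n))" for n
  proof -
    have "Inf (norm ` C n) < d n + inverse (real (Suc n))" by (simp add: d_def)
    then show ?thesis using cInf_lessD[of "norm ` C n"] ne by fastforce
  qed
  then obtain z where z: "\<And>n. z n \<in> C n" "\<And>n. norm (z n) < d n + inverse (real (Suc n))"
    by metis
  \<comment> \<open>Parallelogram bound for \<open>z n - z m\<close> with \<open>n \<le> m\<close>:
    both norms are at most \<open>D + inverse (real (Suc n))\<close>, and the midpoint lies in
    \<open>C n\<close>, so its norm is at least \<open>d n\<close>.\<close>
  define e where "e n = 4 * ((D + inverse (real (Suc n)))\<^sup>2 - (d n)\<^sup>2)" for n
  have "e \<longlonglongrightarrow> 4 * ((D + 0)\<^sup>2 - D\<^sup>2)"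
    unfolding e_def by (intro tendsto_intros D LIMSEQ_inverse_real_of_nat)
  then have e0: "e \<longlonglongrightarrow> 0" by simp
  have ze: "(norm (z n - z m))\<^sup>2 \<le> e n" if nm: "n \<le> m" for n m
  proof -
    have "z m \<in> C n" using sub[OF nm] z(1) by blast
    then have "(1/2) *\<^sub>R z n + (1/2) *\<^sub>R z m \<in> C n"
      using z(1) by (intro convexD[OF cv]) auto
    from d_le[OF this] have "d n \<le> norm (z n + z m) / 2"
      by (simp add: scaleR_add_right[symmetric])
    then have "2 * d n \<le> norm (z n + z m)" by simp
    then have 1: "4 * (d n)\<^sup>2 \<le> (norm (z n + z m))\<^sup>2"
      using power_mono[of "2 * d n" "norm (z n + z m)" 2] d0 by (simp add: power_mult_distrib)
    have b: "(norm (z k))\<^sup>2 \<le> (D + inverse (real (Suc n)))\<^sup>2" if "n \<le> k" for k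
    proof (rule power_mono)
      have "inverse (real (Suc k)) \<le> inverse (real (Suc n))" using that by (simp add: field_simps)
      then show "norm (z k) \<le> D + inverse (real (Suc n))" using z(2)[of k] dD[of k] by linarith
    qed simp
    have "(norm (z n - z m))\<^sup>2 = 2 * (norm (z n))\<^sup>2 + 2 * (norm (z m))\<^sup>2 - (norm (z n + z m))\<^sup>2"
      by (simp add: power2_norm_eq_inner inner_simps inner_commute)
    then show ?thesis using 1 b[of n] b[OF nm] by (simp add: e_def)
  qed
  have "Cauchy z"
  proof (rule metric_CauchyI)
    fix r :: real assume r: "0 < r"
    then have "eventually (\<lambda>n. e n < (r/2)\<^sup>2) sequentially"
      by (intro order_tendstoD(2)[OF e0]) auto
    then obtain N where "e N < (r/2)\<^sup>2" by (auto simp: eventually_sequentially)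
    then have "norm (z N - z m) < r/2" if "N \<le> m" for m
      using ze[OF that] r by (intro power2_less_imp_less[of _ "r/2"]) auto
    then have "dist (z m) (z n) < r" if "N \<le> m" "N \<le> n" for m n
      using that dist_triangle_half_l[of "z N"] by (metis dist_commute dist_norm dist_triangle_half_r)
    then show "\<exists>N. \<forall>m\<ge>N. \<forall>n\<ge>N. dist (z m) (z n) < r" by blast
  qed
  then obtain x where x: "z \<longlonglongrightarrow> x" by (auto simp: Cauchy_convergent_iff convergent_def)
  have xC: "x \<in> C n" for n
  proof (rule Lim_in_closed_set[OF cl _ _ x])
    show "\<forall>\<^sub>F m in sequentially. z m \<in> C n"
      using eventually_ge_at_top[of n] by eventually_elim (use sub z(1) in blast)
  qed simp
  have "norm x \<le> D + 0"
    by (rule LIMSEQ_le[OF tendsto_norm[OF x] tendsto_add[OF D LIMSEQ_inverse_real_of_nat]])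
       (use z(2) less_imp_le in blast)
  moreover have "D \<le> norm y" if "y \<in> (\<Inter>n. C n)" for y
    using that d_le by (intro LIMSEQ_le_const2[OF D]) auto
  ultimately have "norm x \<le> norm y" if "y \<in> (\<Inter>n. C n)" for y
    using that by fastforce
  then show thesis using that[of x] xC by blast
qed

text \<open>The normal is \<open>w = q - p\<close> with \<open>p\<close> the point of the closure
  nearest to \<open>q\<close>. From \<open>p\<close> one may move within the closure along each
  \<open>k\<close> in \<open>E\<close>, and along \<open>- p\<close> by shrinking; the latter gives
  \<open>w \<bullet> p \<ge> 0\<close>, hence
  \<open>w \<bullet> q \<ge> w \<bullet> w > 0\<close>.\<close>

lemma convex_cone_separation:
  fixes E :: "'b::{real_inner, complete_space} set"
  assumes ne: "E \<noteq> {}" and add: "\<And>x y. x \<in> E \<Longrightarrow> y \<in> E \<Longrightarrow> x + y \<in> E"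
    and scale: "\<And>x c. x \<in> E \<Longrightarrow> 0 < c \<Longrightarrow> c *\<^sub>R x \<in> E" and q: "q \<notin> closure E"
  obtains w where "\<And>k. k \<in> E \<Longrightarrow> w \<bullet> k \<le> 0" "w \<bullet> q > 0"
proof -
  have "convex E"
  proof (rule convexI)
    fix x y :: 'b and u v :: real
    assume "x \<in> E" "y \<in> E" "0 \<le> u" "0 \<le> v" "u + v = 1"
    then show "u *\<^sub>R x + v *\<^sub>R y \<in> E"
      using add scale by (cases "u = 0"; cases "v = 0") auto
  qed
  then have cvE: "convex ((\<lambda>x. x - q) ` closure E)"
    by (intro convex_translation_subtract convex_closure)
  have clE: "closed ((\<lambda>x. x - q) ` closure E)" by (rule closed_translation_subtract) simp
  obtain y0 where y0: "y0 \<in> (\<lambda>x. x - q) ` closure E" using ne closure_subset by blast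
  \<comment> \<open>Translating by \<open>- q\<close> turns the nearest point into a point of least
    norm; the sequence of sets is constant.\<close>
  obtain p where p: "p \<in> closure E" and min: "\<And>k. k \<in> closure E \<Longrightarrow> norm (p - q) \<le> norm (k - q)"
  proof (rule nested_convex_min_norm[of "\<lambda>_. (\<lambda>x. x - q) ` closure E" "norm y0"])
    show "closed ((\<lambda>x. x - q) ` closure E)" "convex ((\<lambda>x. x - q) ` closure E)"
      using clE cvE .
  qed (use y0 in \<open>auto simp: decseq_def\<close>)
  define w where "w = q - p"
  have w0: "w \<noteq> 0" using p q by (auto simp: w_def)
  have cadd: "x + y \<in> closure E" if xy: "x \<in> closure E" "y \<in> closure E" for x y
  proof -
    obtain X Y where "\<And>n. X n \<in> E" "X \<longlonglongrightarrow> x" "\<And>n. Y n \<in> E" "Y \<longlonglongrightarrow> y"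
      using xy unfolding closure_sequential by metis
    then show ?thesis unfolding closure_sequential
      by (intro exI[of _ "\<lambda>n. X n + Y n"]) (auto intro: tendsto_add add)
  qed
  have cscale: "c *\<^sub>R x \<in> closure E" if x: "x \<in> closure E" and c: "0 < c" for x c
  proof -
    obtain X where "\<And>n. X n \<in> E" "X \<longlonglongrightarrow> x"
      using x unfolding closure_sequential by metis
    then show ?thesis unfolding closure_sequential
      by (intro exI[of _ "\<lambda>n. c *\<^sub>R X n"]) (auto intro: tendsto_intros scale c)
  qed
  \<comment> \<open>Minimality of \<open>p\<close> in the direction \<open>k\<close>, squared.
    Dividing by \<open>t\<close> and letting \<open>t\<close> tend to 0, which is the content of
    \<open>lim0\<close>, leaves \<open>w \<bullet> k \<le> 0\<close>.\<close>
  have nn: "t * (w \<bullet> k) * 2 \<le> t\<^sup>2 * (norm k)\<^sup>2" if "p + t *\<^sub>R k \<in> closure E" for t k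
  proof -
    have "norm w \<le> norm (w - t *\<^sub>R k)"
      using min[OF that] by (simp add: w_def norm_minus_commute algebra_simps)
    then have "(norm w)\<^sup>2 \<le> (norm (w - t *\<^sub>R k))\<^sup>2" by (rule power_mono) simp
    then show ?thesis unfolding power2_norm_eq_inner
      by (simp add: inner_simps inner_commute power2_eq_square)
  qed
  have lim0: "a \<le> 0" if "\<And>t. 0 < t \<Longrightarrow> t < 1 \<Longrightarrow> t * a * 2 \<le> t\<^sup>2 * b" for a b :: real
  proof (rule ccontr)
    assume "\<not> a \<le> 0"
    \<comment> \<open>Small enough for \<open>t * b \<le> a\<close>, against
      \<open>a * 2 \<le> t * b\<close> with \<open>a > 0\<close>.\<close>
    define t where "t = min (1/2) (a / (\<bar>b\<bar> + 1))"
    have t: "0 < t" "t < 1" using \<open>\<not> a \<le> 0\<close> by (auto simp: t_def)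
    have "t \<le> a / (\<bar>b\<bar> + 1)" by (simp add: t_def)
    then have ta: "t * (\<bar>b\<bar> + 1) \<le> a" by (simp add: pos_le_divide_eq)
    have "t * (a * 2) \<le> t * (t * b)" using that[OF t(1,2)] by (simp add: power2_eq_square mult_ac)
    then have "a * 2 \<le> t * b" using t(1) by simp
    also have "\<dots> \<le> t * (\<bar>b\<bar> + 1)" using t(1) by (intro mult_left_mono) auto
    finally show False using ta \<open>\<not> a \<le> 0\<close> by linarith
  qed
  have le: "w \<bullet> k \<le> 0" if "k \<in> E" for k
    using that closure_subset cadd[OF p] scale
    by (intro lim0[of _ "(norm k)\<^sup>2"] nn) blast
  have "- (w \<bullet> p) \<le> 0"
  proof (rule lim0[of _ "(norm p)\<^sup>2"])
    fix t :: real assume t: "0 < t" "t < 1"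
    have "p + t *\<^sub>R (- p) = (1 - t) *\<^sub>R p" by (simp add: algebra_simps)
    then show "t * - (w \<bullet> p) * 2 \<le> t\<^sup>2 * (norm p)\<^sup>2"
      using nn[of t "- p"] cscale[OF p, of "1 - t"] t by simp
  qed
  moreover have "w \<bullet> w > 0" using w0 by simp
  ultimately have "w \<bullet> q > 0" by (simp add: w_def inner_simps)
  with le show thesis by (rule that)
qed

section \<open>Interior points and normal vectors of convex sets\<close>

text \<open>A ball of radius \<open>e\<close> about \<open>c\<close> shrinks to one of radius
  \<open>u * e\<close> about the combination. Since \<open>x\<close> need only lie in
  \<open>S\<close>, segments may end at boundary points.\<close>

lemma convex_interior_combination:
  fixes S :: "'b::real_normed_vector set"
  assumes S: "convex S" and c: "c \<in> interior S" and x: "x \<in> S" and u: "0 < u" "u \<le> 1"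
  shows "u *\<^sub>R c + (1 - u) *\<^sub>R x \<in> interior S"
proof -
  obtain e where e: "0 < e" "ball c e \<subseteq> S" using c by (auto simp: mem_interior)
  have "ball (u *\<^sub>R c + (1 - u) *\<^sub>R x) (u * e) \<subseteq> S"
  proof
    fix y assume y: "y \<in> ball (u *\<^sub>R c + (1 - u) *\<^sub>R x) (u * e)"
    define d where "d = (1/u) *\<^sub>R (y - (u *\<^sub>R c + (1 - u) *\<^sub>R x))"
    have "norm d = dist (u *\<^sub>R c + (1 - u) *\<^sub>R x) y / u"
      using u by (simp add: d_def dist_norm norm_minus_commute)
    then have "norm d < e" using y u by (simp add: pos_divide_less_eq mult.commute)
    then have "c + d \<in> S" using e by (auto simp: dist_norm)
    then have "u *\<^sub>R (c + d) + (1 - u) *\<^sub>R x \<in> S" using x u by (intro convexD[OF S]) auto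
    moreover have "u *\<^sub>R (c + d) + (1 - u) *\<^sub>R x = y"
      using u by (simp add: d_def scaleR_add_right)
    ultimately show "y \<in> S" by simp
  qed
  then show ?thesis using e u unfolding mem_interior by (intro exI[of _ "u * e"]) auto
qed

text \<open>The cone \<open>E\<close> of feasible directions at \<open>x\<close> is separated from
  \<open>x - c\<close>, which points away from the interior. If feasible directions came arbitrarily
  close to \<open>x - c\<close>, then \<open>x\<close> would be an interior point.\<close>

lemma convex_normal_vector:
  fixes S :: "'b::{real_inner, complete_space} set"
  assumes S: "convex S" and c: "c \<in> interior S" and x: "x \<in> S" "x \<notin> interior S"
  obtains w where "w \<noteq> 0" "\<And>y. y \<in> S \<Longrightarrow> w \<bullet> (y - x) \<le> 0"
proof -
  define E where "E = {h. \<exists>t>0. x + t *\<^sub>R h \<in> S}"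
  have SE: "y - x \<in> E" if "y \<in> S" for y
    using that unfolding E_def by (intro CollectI exI[of _ 1]) auto
  obtain w where w: "\<And>k. k \<in> E \<Longrightarrow> w \<bullet> k \<le> 0" "w \<bullet> (x - c) > 0"
  proof (rule convex_cone_separation[of E "x - c"])
    show "E \<noteq> {}" using SE[OF x(1)] by blast
  next
    fix h k assume "h \<in> E" "k \<in> E"
    then obtain t s where t: "0 < t" "x + t *\<^sub>R h \<in> S" and s: "0 < s" "x + s *\<^sub>R k \<in> S"
      by (auto simp: E_def)
    \<comment> \<open>These weights give \<open>h\<close> and \<open>k\<close> the same coefficient
      \<open>t * s / (t + s)\<close>.\<close>
    have "(s / (t + s)) *\<^sub>R (x + t *\<^sub>R h) + (t / (t + s)) *\<^sub>R (x + s *\<^sub>R k) \<in> S"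
      using t s by (intro convexD[OF S]) (auto simp: add_divide_distrib[symmetric] add.commute)
    also have "(s / (t + s)) *\<^sub>R (x + t *\<^sub>R h) + (t / (t + s)) *\<^sub>R (x + s *\<^sub>R k)
        = (s / (t + s) + t / (t + s)) *\<^sub>R x + (t * s / (t + s)) *\<^sub>R (h + k)"
      by (simp add: algebra_simps)
    also have "s / (t + s) + t / (t + s) = 1"
      using t s by (simp add: add_divide_distrib[symmetric] add.commute)
    finally show "h + k \<in> E" using t s unfolding E_def
      by (intro CollectI exI[of _ "t * s / (t + s)"]) auto
  next
    fix h and b :: real assume "h \<in> E" "0 < b"
    then obtain t where t: "0 < t" "x + t *\<^sub>R h \<in> S" by (auto simp: E_def)
    then show "b *\<^sub>R h \<in> E" using \<open>0 < b\<close> unfolding E_def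
      by (intro CollectI exI[of _ "t / b"]) auto
  next
    show "x - c \<notin> closure E"
    proof
      assume cl: "x - c \<in> closure E"
      obtain e where e: "0 < e" "ball c e \<subseteq> interior S"
        using c open_interior open_contains_ball by metis
      obtain h where h: "h \<in> E" "dist h (x - c) < e"
        using cl e(1) by (auto simp: closure_approachable)
      obtain t where t: "0 < t" "x + t *\<^sub>R h \<in> S" using h by (auto simp: E_def)
      \<comment> \<open>As \<open>h\<close> is near \<open>x - c\<close>, the point
        \<open>x - h\<close> is near \<open>c\<close>; now \<open>x\<close> lies strictly between
        the interior point \<open>x - h\<close> and the point \<open>x + t *\<^sub>R h\<close> of
        \<open>S\<close>.\<close>
      have "x - h \<in> ball c e" using h(2) by (simp add: dist_norm algebra_simps norm_minus_commute)
      then have "x - h \<in> interior S" using e by blast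
      from convex_interior_combination[OF S this t(2), of "t / (1 + t)"]
      have "(t / (1 + t)) *\<^sub>R (x - h) + (1 - t / (1 + t)) *\<^sub>R (x + t *\<^sub>R h) \<in> interior S"
        using t by simp
      moreover have "1 - t / (1 + t) = 1 / (1 + t)" using t by (simp add: field_simps)
      moreover have "(t / (1 + t)) *\<^sub>R (x - h) + (1 / (1 + t)) *\<^sub>R (x + t *\<^sub>R h)
          = (t / (1 + t) + 1 / (1 + t)) *\<^sub>R x" by (simp add: algebra_simps)
      moreover have "t / (1 + t) + 1 / (1 + t) = 1"
        using t by (simp add: add_divide_distrib[symmetric] add.commute)
      ultimately show False using x(2) by simp
    qed
  qed blast
  have "w \<noteq> 0" using w(2) by auto
  moreover have "w \<bullet> (y - x) \<le> 0" if "y \<in> S" for y using w(1)[OF SE[OF that]] .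
  ultimately show thesis by (rule that)
qed

section \<open>Convex functions and local upper bounds\<close>

text \<open>Real upper bounds in place of the values keep the arithmetic out of
  \<open>ereal\<close>, and the weights 0 and 1 are included.\<close>

lemma convex_funD:
  assumes f: "convex_fun f" and "f x \<le> ereal a" "f y \<le> ereal b" and u: "0 \<le> u" "u \<le> 1"
  shows "f (u *\<^sub>R x + (1 - u) *\<^sub>R y) \<le> ereal (u * a + (1 - u) * b)"
proof (cases "u = 0 \<or> u = 1")
  case False
  then have "0 < u" "u < 1" using u by auto
  then have "f (u *\<^sub>R x + (1 - u) *\<^sub>R y) \<le> ereal u * f x + ereal (1 - u) * f y"
    using f unfolding convex_fun_def by blast
  also have "\<dots> \<le> ereal u * ereal a + ereal (1 - u) * ereal b"
    using assms by (intro add_mono ereal_mult_left_mono) auto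
  finally show ?thesis by simp
qed (use assms in auto)

lemma lower_semicontinuous_eventually_gt:
  assumes "lower_semicontinuous f" "c < f x"
  shows "eventually (\<lambda>y. c < f y) (nhds x)"
  using assms by (auto simp: lower_semicontinuous_def le_Liminf_iff eventually_nhds_conv_at)

lemma lower_semicontinuous_closed_sublevel:
  assumes "lower_semicontinuous f"
  shows "closed {x. f x \<le> c}"
proof -
  have "open {x. c < f x}"
    by (subst open_subopen) (metis (mono_tags) assms eventually_nhds lower_semicontinuous_eventually_gt mem_Collect_eq subsetI)
  then show ?thesis by (simp add: closed_def Compl_eq not_le)
qed

text \<open>By Baire, one of the closed sublevel sets covering the domain contains a ball, about
  some \<open>z\<close>. Convexity carries the bound to \<open>x\<close>, written as a combination
  of \<open>z\<close> and a domain point \<open>w\<close> slightly beyond \<open>x\<close>.\<close>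

lemma Gamma0_bounded_above_near:
  fixes f :: "'b::{real_inner, complete_space} \<Rightarrow> ereal"
  assumes f: "f \<in> Gamma0" and x: "x \<in> interior (edom f)"
  obtains r N where "0 < r" "\<And>u. norm u \<le> r \<Longrightarrow> f (x + u) \<le> ereal N"
proof -
  have lsc: "lower_semicontinuous f" and cv: "convex_fun f" using f by (auto simp: Gamma0_def)
  have "\<exists>n::nat. interior {y. f y \<le> ereal n} \<noteq> {}"
  proof (rule ccontr)
    assume "\<not> ?thesis"
    then have "interior (\<Union>(range (\<lambda>n::nat. {y. f y \<le> ereal n}))) = {}"
      using Met_TC.metric_Baire_category_alt[of "range (\<lambda>n::nat. {y. f y \<le> ereal n})"]
        lower_semicontinuous_closed_sublevel[OF lsc] complete_UNIV by auto
    moreover have "edom f \<subseteq> \<Union>(range (\<lambda>n::nat. {y. f y \<le> ereal n}))"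
    proof
      fix y assume "y \<in> edom f"
      then show "y \<in> \<Union>(range (\<lambda>n::nat. {y. f y \<le> ereal n}))"
        using real_arch_simple by (cases "f y") (auto simp: edom_def)
    qed
    ultimately show False using x interior_mono by blast
  qed
  then obtain n :: nat and z e where e: "0 < e" "ball z e \<subseteq> {y. f y \<le> ereal n}"
    by (auto simp: mem_interior)
  obtain d where d: "0 < d" "ball x d \<subseteq> edom f" using x by (auto simp: mem_interior)
  \<comment> \<open>The summand 1 keeps \<open>g\<close> positive when \<open>x = z\<close>.\<close>
  define g where "g = norm (x - z) + 1"
  have g: "0 < g" by (simp add: g_def add_nonneg_pos)
  define s where "s = d / (2 * g)"
  have s: "0 < s" using d g by (simp add: s_def)
  define w where "w = x + s *\<^sub>R (x - z)"
  have "s * norm (x - z) < d"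
  proof -
    have "s * norm (x - z) \<le> s * g" using s by (simp add: g_def)
    also have "\<dots> = d / 2" using g by (simp add: s_def)
    finally show ?thesis using d by simp
  qed
  then have "w \<in> edom f" using d(2) s by (auto simp: w_def dist_norm)
  then obtain b where b: "f w \<le> ereal b" by (cases "f w") (auto simp: edom_def)
  define l where "l = s / (1 + s)"
  have l: "0 < l" "l \<le> 1" using s by (auto simp: l_def)
  have xl: "x = l *\<^sub>R z + (1 - l) *\<^sub>R w"
  proof -
    have "l *\<^sub>R z + (1 - l) *\<^sub>R w = (l - (1 - l) * s) *\<^sub>R z + ((1 - l) * (1 + s)) *\<^sub>R x"
      by (simp add: w_def algebra_simps)
    moreover have "l - (1 - l) * s = 0" "(1 - l) * (1 + s) = 1" using s by (auto simp: l_def field_simps)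
    ultimately show ?thesis by simp
  qed
  show thesis
  proof
    \<comment> \<open>Half of \<open>l * e\<close>, because the ball about \<open>z\<close> is open
      while the bound is claimed on a closed ball.\<close>
    show "0 < l * e / 2" using l e by simp
  next
    fix u :: 'b assume u: "norm u \<le> l * e / 2"
    have "0 < l * e" using l e by simp
    then have "norm u < l * e" using u by linarith
    then have "norm ((1/l) *\<^sub>R u) < e" using l by (simp add: pos_divide_less_eq mult.commute)
    then have "z + (1/l) *\<^sub>R u \<in> ball z e" by (simp add: dist_norm)
    then have "f (z + (1/l) *\<^sub>R u) \<le> ereal n" using e(2) by blast
    from convex_funD[OF cv this b, of l] l
    have "f (l *\<^sub>R (z + (1/l) *\<^sub>R u) + (1 - l) *\<^sub>R w) \<le> ereal (l * n + (1 - l) * b)" by simp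
    also have "l *\<^sub>R (z + (1/l) *\<^sub>R u) + (1 - l) *\<^sub>R w = x + u"
      using l by (subst xl) (simp add: algebra_simps)
    finally show "f (x + u) \<le> ereal (l * n + (1 - l) * b)" .
  qed
qed

section \<open>Directional derivatives and subgradients\<close>

text \<open>The hypothesis \<open>lb\<close> says that the directional derivative at
  \<open>x\<close> along \<open>h\<close> is at least \<open>b\<close>. The cone \<open>E\<close>
  lies between the strict epigraph and the epigraph of that derivative, and a hyperplane separating
  \<open>(h, c)\<close> from \<open>E\<close> is the graph of a subgradient.\<close>

lemma subgradient_direction_gt:
  fixes f :: "'b::{real_inner, complete_space} \<Rightarrow> ereal"
  assumes f: "f \<in> Gamma0" and x: "x \<in> interior (edom f)" and a: "f x = ereal a"
    and cb: "c < b" and lb: "\<And>t. 0 < t \<Longrightarrow> ereal (a + t * b) \<le> f (x + t *\<^sub>R h)"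
  obtains v where "v \<in> subdifferential f x" "c < v \<bullet> h"
proof -
  have cv: "convex_fun f" using f by (auto simp: Gamma0_def)
  obtain r N where r: "0 < r" and N: "\<And>u. norm u \<le> r \<Longrightarrow> f (x + u) \<le> ereal N"
    using Gamma0_bounded_above_near[OF f x] by metis
  \<comment> \<open>On every ray from \<open>x\<close>, \<open>f\<close> rises by at most
    \<open>\<bar>N - a\<bar>\<close> at distance \<open>r\<close>, so \<open>K * norm k\<close> is
    an admissible height over \<open>k\<close>.\<close>
  define K where "K = \<bar>N - a\<bar> / r"
  define E where "E = {(k, s). \<exists>t>0. f (x + t *\<^sub>R k) \<le> ereal (a + t * s)}"
  have KE: "(k, K * norm k) \<in> E" for k
  proof (cases "k = 0")
    case True
    then show ?thesis using a by (auto simp: E_def intro!: exI[of _ 1])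
  next
    case False
    have "f (x + (r / norm k) *\<^sub>R k) \<le> ereal N" using r False by (intro N) simp
    also have "\<dots> \<le> ereal (a + (r / norm k) * (K * norm k))" using False r by (simp add: K_def)
    finally show ?thesis using r False unfolding E_def
      by (intro CollectI case_prodI exI[of _ "r / norm k"]) auto
  qed
  have Eadd: "(k + k', s + s') \<in> E" if E: "(k, s) \<in> E" "(k', s') \<in> E" for k s k' s'
  proof -
    obtain t where t: "0 < t" "f (x + t *\<^sub>R k) \<le> ereal (a + t * s)" using E by (auto simp: E_def)
    obtain t' where t': "0 < t'" "f (x + t' *\<^sub>R k') \<le> ereal (a + t' * s')" using E by (auto simp: E_def)
    \<comment> \<open>Chosen so that \<open>u * t\<close> and \<open>(1 - u) * t'\<close>
      agree.\<close>
    define u where "u = t' / (t + t')"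
    have u: "0 \<le> u" "u \<le> 1" "u * t = t * t' / (t + t')" "(1 - u) * t' = t * t' / (t + t')"
      using t t' by (auto simp: u_def field_simps)
    from convex_funD[OF cv t(2) t'(2) u(1,2)]
    have "f (u *\<^sub>R (x + t *\<^sub>R k) + (1 - u) *\<^sub>R (x + t' *\<^sub>R k'))
        \<le> ereal (u * (a + t * s) + (1 - u) * (a + t' * s'))" .
    also have "u *\<^sub>R (x + t *\<^sub>R k) + (1 - u) *\<^sub>R (x + t' *\<^sub>R k')
        = x + (u * t) *\<^sub>R k + ((1 - u) * t') *\<^sub>R k'" by (simp add: algebra_simps)
    also have "u * (a + t * s) + (1 - u) * (a + t' * s') = a + (u * t) * s + ((1 - u) * t') * s'"
      by (simp add: algebra_simps)
    finally show ?thesis using t t' unfolding E_def u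
      by (intro CollectI case_prodI exI[of _ "t * t' / (t + t')"])
         (auto simp: scaleR_add_right distrib_left add.assoc)
  qed
  have Ege: "b \<le> s" if "(h, s) \<in> E" for s
  proof -
    obtain t where "0 < t" "f (x + t *\<^sub>R h) \<le> ereal (a + t * s)" using \<open>(h, s) \<in> E\<close> by (auto simp: E_def)
    with order_trans[OF lb this(2)] show ?thesis by simp
  qed
  obtain w where w: "\<And>p. p \<in> E \<Longrightarrow> w \<bullet> p \<le> 0" "w \<bullet> (h, c) > 0"
  proof (rule convex_cone_separation[of E "(h, c)"])
    show "E \<noteq> {}" using KE by blast
  next
    fix p q assume "p \<in> E" "q \<in> E"
    then show "p + q \<in> E" using Eadd by (cases p; cases q) auto
  next
    fix p and m :: real assume p: "p \<in> E" and m: "0 < m"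
    obtain k s where ks: "p = (k, s)" by (cases p)
    obtain t where "0 < t" "f (x + t *\<^sub>R k) \<le> ereal (a + t * s)" using p by (auto simp: E_def ks)
    then show "m *\<^sub>R p \<in> E" using m unfolding E_def ks
      by (auto intro!: exI[of _ "t / m"])
  next
    show "(h, c) \<notin> closure E"
    proof
      assume "(h, c) \<in> closure E"
      then obtain Z where Z: "\<And>n. Z n \<in> E" "Z \<longlonglongrightarrow> (h, c)" unfolding closure_sequential by metis
      \<comment> \<open>Adding \<open>h - fst (Z n)\<close> with height
        \<open>K * norm (h - fst (Z n))\<close> moves the point of \<open>E\<close> exactly over
        \<open>h\<close>, where heights are at least \<open>b\<close>; the correction vanishes in
        the limit.\<close>
      have "b \<le> snd (Z n) + K * norm (h - fst (Z n))" for n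
        using Eadd[OF _ KE, of "fst (Z n)" "snd (Z n)" "h - fst (Z n)"] Z(1)[of n] by (intro Ege) simp
      moreover have "(\<lambda>n. snd (Z n) + K * norm (h - fst (Z n))) \<longlonglongrightarrow> c + K * norm (h - h)"
        using tendsto_fst[OF Z(2)] tendsto_snd[OF Z(2)] by (intro tendsto_intros) auto
      ultimately have "b \<le> c + K * norm (h - h)" by (intro LIMSEQ_le_const) auto
      then show False using cb by simp
    qed
  qed blast
  obtain z s where ws: "w = (z, s)" by (cases w)
  have zs: "z \<bullet> k + s * m \<le> 0" if "(k, m) \<in> E" for k m using w(1)[OF that] by (simp add: ws)
  have zh: "z \<bullet> h + s * c > 0" using w(2) by (simp add: ws)
  \<comment> \<open>The hyperplane is not vertical: upward directions give \<open>s \<le> 0\<close>,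
    and \<open>s = 0\<close> would force \<open>z \<bullet> h \<le> 0\<close> because
    \<open>E\<close> has a point over \<open>h\<close>.\<close>
  have "(0, 1) \<in> E" using a by (auto simp: E_def intro!: exI[of _ 1])
  then have "s \<le> 0" using zs by fastforce
  moreover have "s \<noteq> 0" using zs[OF KE, of h] zh by auto
  ultimately have s: "s < 0" by simp
  define v where "v = (- 1 / s) *\<^sub>R z"
  have "v \<in> subdifferential f x"
    unfolding subdifferential_def
  proof (intro CollectI allI)
    fix y
    show "f x + ereal (v \<bullet> (y - x)) \<le> f y"
    proof (cases "f y")
      case (real m)
      then have "(y - x, m - a) \<in> E" by (auto simp: E_def intro!: exI[of _ 1])
      from zs[OF this] have "v \<bullet> (y - x) \<le> m - a" using s by (simp add: v_def field_simps)
      then show ?thesis using real a by simp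
    qed (use f in \<open>auto simp: Gamma0_def proper_fun_def\<close>)
  qed
  moreover have "c < v \<bullet> h" using zh s by (simp add: v_def field_simps)
  ultimately show thesis by (rule that)
qed

lemma subdifferential_finite:
  assumes f: "proper_fun f" and v: "v \<in> subdifferential f x"
  obtains a where "f x = ereal a"
proof -
  obtain y where y: "f y < \<infinity>" using f by (auto simp: proper_fun_def edom_def)
  have "f x + ereal (v \<bullet> (y - x)) \<le> f y" using v by (simp add: subdifferential_def)
  then have "f x \<noteq> \<infinity>" using y by auto
  moreover have "f x \<noteq> -\<infinity>" using f by (simp add: proper_fun_def)
  ultimately show thesis using that by (cases "f x") auto
qed

lemma subdifferential_ne_empty_interior:
  fixes f :: "'b::{real_inner, complete_space} \<Rightarrow> ereal"
  assumes f: "f \<in> Gamma0" and x: "x \<in> interior (edom f)"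
  shows "subdifferential f x \<noteq> {}"
proof -
  have "f x < \<infinity>" "f x \<noteq> -\<infinity>"
    using f x interior_subset by (auto simp: edom_def Gamma0_def proper_fun_def)
  then obtain a where a: "f x = ereal a" by (cases "f x") auto
  show ?thesis
    \<comment> \<open>The direction is 0, along which \<open>f\<close> is constantly
      \<open>a\<close>; only the existence of a subgradient is wanted.\<close>
    by (rule subgradient_direction_gt[OF f x a, of "-1" 0 0]) (use a in auto)
qed

section \<open>Gateaux derivatives and unique subgradients\<close>

text \<open>The subgradient inequality bounds one-sided quotients from below along \<open>h\<close>
  and along \<open>- h\<close>; linearity of \<open>L\<close> turns the two bounds into an
  equality.\<close>

lemma has_gateaux_derivative_subgradient:
  assumes f: "proper_fun f" and L: "has_gateaux_derivative f L x" and v: "v \<in> subdifferential f x"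
  shows "L h = v \<bullet> h"
proof -
  obtain a where a: "f x = ereal a" using subdifferential_finite[OF f v] .
  have le: "v \<bullet> h \<le> L h" for h
  proof -
    have "((\<lambda>t::real. (f (x + t *\<^sub>R h) - f x) / ereal t) \<longlongrightarrow> ereal (L h)) (at_right 0)"
      using L unfolding has_gateaux_derivative_def by (blast intro: tendsto_within_subset)
    moreover have "\<forall>\<^sub>F t::real in at_right 0. ereal (v \<bullet> h) \<le> (f (x + t *\<^sub>R h) - f x) / ereal t"
      using eventually_at_right_less[of 0]
    proof eventually_elim
      case (elim t)
      have "f x + ereal (v \<bullet> ((x + t *\<^sub>R h) - x)) \<le> f (x + t *\<^sub>R h)"
        using v unfolding subdifferential_def by blast
      then show ?case using a elim
        by (cases "f (x + t *\<^sub>R h)") (auto simp: field_simps)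
    qed
    ultimately have "ereal (v \<bullet> h) \<le> ereal (L h)" by (intro tendsto_lowerbound) auto
    then show ?thesis by simp
  qed
  have "linear L" using L by (simp add: has_gateaux_derivative_def bounded_linear.linear)
  then show ?thesis using le[of h] le[of "- h"] by (simp add: linear_neg)
qed

text \<open>An interior point has some subgradient, and each subgradient represents
  \<open>L\<close>. This also shows that the description in \<open>gateaux_gradient\<close> denotes
  a unique vector.\<close>

lemma gateaux_subdifferential:
  fixes f :: "'b::{real_inner, complete_space} \<Rightarrow> ereal"
  assumes f: "f \<in> Gamma0" and x: "x \<in> interior (edom f)" and L: "has_gateaux_derivative f L x"
  shows "subdifferential f x = {gateaux_gradient f x}"
proof -
  have pf: "proper_fun f" using f by (simp add: Gamma0_def)
  obtain v where v: "v \<in> subdifferential f x" using subdifferential_ne_empty_interior[OF f x] by blast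
  have "L = (\<lambda>h. v \<bullet> h)" using has_gateaux_derivative_subgradient[OF pf L v] by blast
  then have "has_gateaux_derivative f (\<lambda>h. v \<bullet> h) x" using L by simp
  moreover have "u = v" if "has_gateaux_derivative f (\<lambda>h. u \<bullet> h) x" for u
    using has_gateaux_derivative_subgradient[OF pf that v] by (metis vector_eq_rdot)
  ultimately have "gateaux_gradient f x = v"
    unfolding gateaux_gradient_def by (rule the_equality)
  moreover have "w = v" if "w \<in> subdifferential f x" for w
    using has_gateaux_derivative_subgradient[OF pf L v] has_gateaux_derivative_subgradient[OF pf L that]
    by (metis vector_eq_rdot)
  ultimately show ?thesis using v by blast
qed

text \<open>If every quotient along \<open>h\<close> were at least \<open>v \<bullet> h + e\<close>,
  there would be a second subgradient with a larger value on \<open>h\<close>. One good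
  \<open>t\<close> suffices, since convexity passes the bound to smaller steps.\<close>

lemma unique_subgradient_upper_bound:
  fixes f :: "'b::{real_inner, complete_space} \<Rightarrow> ereal"
  assumes f: "f \<in> Gamma0" and x: "x \<in> interior (edom f)" and a: "f x = ereal a"
    and v: "subdifferential f x = {v}" and e: "0 < e"
  shows "\<forall>\<^sub>F s in at_right 0. f (x + s *\<^sub>R h) \<le> ereal (a + s * (v \<bullet> h + e))"
proof -
  have "\<exists>t>0. f (x + t *\<^sub>R h) < ereal (a + t * (v \<bullet> h + e))"
  proof (rule ccontr)
    assume "\<not> ?thesis"
    then have "ereal (a + t * (v \<bullet> h + e)) \<le> f (x + t *\<^sub>R h)" if "0 < t" for t
      using that not_less by blast
    then obtain w where "w \<in> subdifferential f x" "v \<bullet> h < w \<bullet> h"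
      by (rule subgradient_direction_gt[OF f x a, of "v \<bullet> h", rotated]) (use e in auto)
    then show False using v by simp
  qed
  then obtain t where t: "0 < t" "f (x + t *\<^sub>R h) \<le> ereal (a + t * (v \<bullet> h + e))"
    using less_imp_le by blast
  have "f (x + s *\<^sub>R h) \<le> ereal (a + s * (v \<bullet> h + e))" if s: "0 < s" "s < t" for s
  proof -
    have "f ((s / t) *\<^sub>R (x + t *\<^sub>R h) + (1 - s / t) *\<^sub>R x)
        \<le> ereal ((s / t) * (a + t * (v \<bullet> h + e)) + (1 - s / t) * a)"
      using f t s a by (intro convex_funD) (auto simp: Gamma0_def)
    also have "(s / t) *\<^sub>R (x + t *\<^sub>R h) + (1 - s / t) *\<^sub>R x = x + s *\<^sub>R h"
      using t by (simp add: scaleR_add_right scaleR_diff_left)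
    also have "(s / t) * (a + t * (v \<bullet> h + e)) + (1 - s / t) * a = a + s * (v \<bullet> h + e)"
      using t by (simp add: field_simps)
    finally show ?thesis .
  qed
  then show ?thesis unfolding eventually_at_right_field using t(1) by blast
qed

lemma unique_subgradient_gateaux:
  fixes f :: "'b::{real_inner, complete_space} \<Rightarrow> ereal"
  assumes f: "f \<in> Gamma0" and x: "x \<in> interior (edom f)" and v: "subdifferential f x = {v}"
  shows "has_gateaux_derivative f (\<lambda>h. v \<bullet> h) x"
proof -
  have pf: "proper_fun f" using f by (simp add: Gamma0_def)
  have "v \<in> subdifferential f x" using v by simp
  then obtain a where a: "f x = ereal a" by (rule subdifferential_finite[OF pf])
  have lb: "ereal (a + s * (v \<bullet> h)) \<le> f (x + s *\<^sub>R h)" for s h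
  proof -
    have "f x + ereal (v \<bullet> ((x + s *\<^sub>R h) - x)) \<le> f (x + s *\<^sub>R h)"
      using v unfolding subdifferential_def by blast
    then show ?thesis using a by simp
  qed
  \<comment> \<open>The witness \<open>m\<close> records that the quotient is finite near 0, so that
    the estimate can be made in the reals.\<close>
  have q: "\<forall>\<^sub>F s in at 0. \<exists>m. (f (x + s *\<^sub>R h) - f x) / ereal s = ereal m \<and> \<bar>m - v \<bullet> h\<bar> \<le> e"
    if e: "0 < e" for h e
  proof -
    have "\<forall>\<^sub>F s in at_right 0. f (x + s *\<^sub>R h) \<le> ereal (a + s * (v \<bullet> h + e))"
      by (rule unique_subgradient_upper_bound[OF f x a v e])
    then have R: "\<forall>\<^sub>F s in at_right 0. \<exists>m. (f (x + s *\<^sub>R h) - f x) / ereal s = ereal m \<and> \<bar>m - v \<bullet> h\<bar> \<le> e"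
      using eventually_at_right_less[of 0]
    proof eventually_elim
      case (elim s)
      then obtain b where b: "f (x + s *\<^sub>R h) = ereal b"
        using lb[of s h] by (cases "f (x + s *\<^sub>R h)") auto
      have "v \<bullet> h \<le> (b - a) / s" "(b - a) / s \<le> v \<bullet> h + e"
        using lb[of s h] elim b by (auto simp: field_simps)
      then show ?case using a b elim by auto
    qed
    \<comment> \<open>Negative steps along \<open>h\<close> are positive steps along
      \<open>- h\<close>; the quotient changes sign.\<close>
    have "\<forall>\<^sub>F s in at_right 0. f (x + s *\<^sub>R (- h)) \<le> ereal (a + s * (v \<bullet> (- h) + e))"
      by (rule unique_subgradient_upper_bound[OF f x a v e])
    then have "\<forall>\<^sub>F s in at_right 0. \<exists>m. (f (x + (- s) *\<^sub>R h) - f x) / ereal (- s) = ereal m \<and> \<bar>m - v \<bullet> h\<bar> \<le> e"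
      using eventually_at_right_less[of 0]
    proof eventually_elim
      case (elim s)
      then obtain b where b: "f (x + (- s) *\<^sub>R h) = ereal b"
        using lb[of "- s" h] by (cases "f (x + (- s) *\<^sub>R h)") auto
      have "v \<bullet> (- h) \<le> (b - a) / s" "(b - a) / s \<le> v \<bullet> (- h) + e"
        using lb[of "- s" h] elim b by (auto simp: field_simps)
      moreover have "(b - a) / (- s) = - ((b - a) / s)" by simp
      ultimately show ?case using a b elim by auto
    qed
    then have "\<forall>\<^sub>F s in at_left 0. \<exists>m. (f (x + s *\<^sub>R h) - f x) / ereal s = ereal m \<and> \<bar>m - v \<bullet> h\<bar> \<le> e"
      by (subst at_left_minus) (simp add: eventually_filtermap)
    with R show ?thesis by (simp add: eventually_at_split)
  qed
  have "((\<lambda>t. (f (x + t *\<^sub>R h) - f x) / ereal t) \<longlongrightarrow> ereal (v \<bullet> h)) (at 0)" for h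
  proof (rule order_tendstoI)
    fix c assume c: "c < ereal (v \<bullet> h)"
    then obtain c' where "c < ereal c'" "c' < v \<bullet> h" using ereal_dense2[OF c] by auto
    from q[of "v \<bullet> h - c'" h] this(2)
    have "\<forall>\<^sub>F t in at 0. ereal c' \<le> (f (x + t *\<^sub>R h) - f x) / ereal t"
      by (auto elim!: eventually_mono)
    then show "\<forall>\<^sub>F t in at 0. c < (f (x + t *\<^sub>R h) - f x) / ereal t"
      by (rule eventually_mono) (rule less_le_trans[OF \<open>c < ereal c'\<close>])
  next
    fix c assume c: "ereal (v \<bullet> h) < c"
    then obtain c' where "ereal c' < c" "v \<bullet> h < c'" using ereal_dense2[OF c] by auto
    from q[of "c' - v \<bullet> h" h] this(2)
    have "\<forall>\<^sub>F t in at 0. (f (x + t *\<^sub>R h) - f x) / ereal t \<le> ereal c'"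
      by (auto elim!: eventually_mono)
    then show "\<forall>\<^sub>F t in at 0. (f (x + t *\<^sub>R h) - f x) / ereal t < c"
      by (rule eventually_mono) (rule le_less_trans[OF _ \<open>ereal c' < c\<close>])
  qed
  then show ?thesis
    using a by (simp add: has_gateaux_derivative_def bounded_linear_inner_right)
qed

section \<open>Subgradients at and near the boundary\<close>

text \<open>On the domain the extra term only lowers the affine minorant, and outside it
  \<open>f\<close> is infinite.\<close>

lemma subdifferential_add_normal:
  assumes v: "v \<in> subdifferential f x" and w: "\<And>y. y \<in> edom f \<Longrightarrow> w \<bullet> (y - x) \<le> 0"
  shows "v + w \<in> subdifferential f x"
  unfolding subdifferential_def
proof (intro CollectI allI)
  fix y
  have "f x + ereal ((v + w) \<bullet> (y - x)) \<le> f x + ereal (v \<bullet> (y - x))" if "y \<in> edom f"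
    using w[OF that] by (intro add_left_mono) (simp add: inner_simps)
  also have "f x + ereal (v \<bullet> (y - x)) \<le> f y" using v by (simp add: subdifferential_def)
  finally show "f x + ereal ((v + w) \<bullet> (y - x)) \<le> f y"
    by (cases "y \<in> edom f") (auto simp: edom_def)
qed

text \<open>For fixed \<open>y\<close>, the subgradient inequalities place the tail of
  \<open>V\<close> in a closed half-space, up to an error tending to 0. Such a half-space also
  contains every point common to the closed convex hulls of the tails.\<close>

lemma subdifferential_closed_bounded:
  fixes f :: "'b::{real_inner, complete_space} \<Rightarrow> ereal"
  assumes f: "proper_fun f" "lower_semicontinuous f" and X: "X \<longlonglongrightarrow> x"
    and V: "\<And>i::nat. V i \<in> subdifferential f (X i)" and M: "\<And>i. norm (V i) \<le> M"
  shows "subdifferential f x \<noteq> {}"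
proof -
  define C where "C n = closure (convex hull (V ` {n..}))" for n
  have VC: "V n \<in> C n" for n
    unfolding C_def by (intro closure_subset[THEN subsetD] hull_inc) auto
  obtain v where v: "\<And>n. v \<in> C n"
  proof (rule nested_convex_min_norm[of C M])
    show "closed (C n)" "convex (C n)" "C n \<noteq> {}" for n
      using VC by (auto simp: C_def convex_closure)
    show "decseq C"
      unfolding decseq_def C_def by (intro allI impI closure_mono hull_mono image_mono) auto
    show "\<exists>y\<in>C n. norm y \<le> M" for n using VC M by blast
  qed blast
  \<comment> \<open>A real \<open>c\<close> below \<open>f x\<close> stands in for the value,
    because \<open>f x\<close> is not yet known to be finite.\<close>
  have key: "v \<bullet> (y - x) \<le> b - c" if y: "f y = ereal b" and c: "ereal c < f x" for y b c
  proof (rule field_le_epsilon)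
    fix e :: real assume e: "0 < e"
    have "(\<lambda>i. M * norm (X i - x)) \<longlonglongrightarrow> M * norm (x - x)" by (intro tendsto_intros X)
    then have "\<forall>\<^sub>F i in sequentially. M * norm (X i - x) < e"
      using e by (intro order_tendstoD(2)) auto
    moreover have "\<forall>\<^sub>F i in sequentially. ereal c < f (X i)"
      using lower_semicontinuous_eventually_gt[OF f(2) c] X by (auto simp: filterlim_iff)
    ultimately have "\<forall>\<^sub>F i in sequentially. M * norm (X i - x) < e \<and> ereal c < f (X i)"
      by (rule eventually_conj)
    then obtain n where n: "\<And>i. n \<le> i \<Longrightarrow> M * norm (X i - x) < e \<and> ereal c < f (X i)"
      by (auto simp: eventually_sequentially)
    have "V i \<bullet> (y - x) \<le> b - c + e" if i: "n \<le> i" for i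
    proof -
      obtain m where m: "f (X i) = ereal m" using subdifferential_finite[OF f(1) V] .
      have "f (X i) + ereal (V i \<bullet> (y - X i)) \<le> f y" using V[of i] unfolding subdifferential_def by blast
      then have 1: "m + V i \<bullet> (y - X i) \<le> b" using m y by simp
      have "V i \<bullet> (X i - x) \<le> norm (V i) * norm (X i - x)" by (rule norm_cauchy_schwarz)
      also have "\<dots> \<le> M * norm (X i - x)" using M by (intro mult_right_mono) auto
      finally show ?thesis using 1 n[OF i] m by (simp add: inner_simps)
    qed
    then have "V ` {n..} \<subseteq> {u. (y - x) \<bullet> u \<le> b - c + e}" by (auto simp: inner_commute)
    then have "C n \<subseteq> {u. (y - x) \<bullet> u \<le> b - c + e}" unfolding C_def
      by (intro closure_minimal hull_minimal convex_halfspace_le closed_halfspace_le)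
    then show "v \<bullet> (y - x) \<le> b - c + e" using v[of n] by (auto simp: inner_commute)
  qed
  obtain y0 b0 where y0: "f y0 = ereal b0"
  proof -
    obtain y where "f y < \<infinity>" "f y \<noteq> -\<infinity>" using f(1) by (auto simp: proper_fun_def edom_def)
    then show thesis using that by (cases "f y") auto
  qed
  \<comment> \<open>If \<open>f x\<close> were infinite, this \<open>c\<close> would be admissible
    and \<open>key\<close> would give a contradiction by 1.\<close>
  have "f x \<noteq> \<infinity>" using key[OF y0, of "b0 - v \<bullet> (y0 - x) + 1"] by auto
  then obtain a where a: "f x = ereal a" using f(1) by (cases "f x") (auto simp: proper_fun_def)
  have "v \<in> subdifferential f x"
    unfolding subdifferential_def
  proof (intro CollectI allI)
    fix y
    show "f x + ereal (v \<bullet> (y - x)) \<le> f y"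
    proof (cases "f y")
      case (real b)
      have "v \<bullet> (y - x) \<le> b - a + e" if "0 < e" for e using key[OF real, of "a - e"] that a by simp
      then have "v \<bullet> (y - x) \<le> b - a" by (rule field_le_epsilon)
      then show ?thesis using a real by simp
    qed (use f in \<open>auto simp: proper_fun_def\<close>)
  qed
  then show ?thesis by blast
qed

text \<open>Testing \<open>g\<close> at the point at distance \<open>r\<close> from \<open>c\<close>
  in the direction of \<open>g\<close> yields \<open>r * norm g\<close> on the side bounded by
  \<open>N\<close>. Monotonicity bounds the remaining terms below by
  \<open>a + v \<bullet> d\<close>, independently of \<open>s\<close>.\<close>

lemma subgradients_bounded_along_segment:
  fixes f :: "'b::{real_inner, complete_space} \<Rightarrow> ereal"
  assumes f: "f \<in> Gamma0" and c: "c \<in> interior (edom f)" and v: "v \<in> subdifferential f x"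
  obtains M where "\<And>s g. 0 < s \<Longrightarrow> s \<le> 1 \<Longrightarrow> g \<in> subdifferential f (s *\<^sub>R c + (1 - s) *\<^sub>R x) \<Longrightarrow> norm g \<le> M"
proof -
  have pf: "proper_fun f" using f by (simp add: Gamma0_def)
  obtain r N where r: "0 < r" and N: "\<And>u. norm u \<le> r \<Longrightarrow> f (c + u) \<le> ereal N"
    using Gamma0_bounded_above_near[OF f c] by metis
  obtain a where a: "f x = ereal a" using subdifferential_finite[OF pf v] .
  define d where "d = c - x"
  show thesis
  proof
    fix s :: real and g assume s: "0 < s" "s \<le> 1" and g: "g \<in> subdifferential f (s *\<^sub>R c + (1 - s) *\<^sub>R x)"
    have z: "s *\<^sub>R c + (1 - s) *\<^sub>R x = x + s *\<^sub>R d" by (simp add: d_def algebra_simps)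
    obtain b where b: "f (x + s *\<^sub>R d) = ereal b"
      using g unfolding z by (rule subdifferential_finite[OF pf])
    have gD: "ereal (b + g \<bullet> (y - (x + s *\<^sub>R d))) \<le> f y" for y
      using g b unfolding z subdifferential_def by auto
    have "f x + ereal (v \<bullet> ((x + s *\<^sub>R d) - x)) \<le> f (x + s *\<^sub>R d)"
      using v unfolding subdifferential_def by blast
    then have 1: "a + s * (v \<bullet> d) \<le> b" using a b by simp
    moreover have "b - s * (g \<bullet> d) \<le> a" using gD[of x] a by simp
    ultimately have "s * (v \<bullet> d) \<le> s * (g \<bullet> d)" by linarith
    then have "v \<bullet> d \<le> g \<bullet> d" using s by simp
    then have 2: "(1 - s) * (v \<bullet> d) \<le> (1 - s) * (g \<bullet> d)" using s by (intro mult_left_mono) auto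
    \<comment> \<open>For \<open>g = 0\<close> the quotient is 0 by convention, so
      \<open>u = 0\<close> and both facts about \<open>u\<close> persist.\<close>
    define u where "u = (r / norm g) *\<^sub>R g"
    have "norm u \<le> r" using r by (simp add: u_def)
    from order_trans[OF gD N[OF this]]
    have "b + g \<bullet> (c + u - (x + s *\<^sub>R d)) \<le> N" by simp
    moreover have "c + u - (x + s *\<^sub>R d) = (1 - s) *\<^sub>R d + u" by (simp add: d_def algebra_simps)
    moreover have "g \<bullet> u = r * norm g" by (simp add: u_def dot_square_norm power2_eq_square)
    ultimately have "b + (1 - s) * (g \<bullet> d) + r * norm g \<le> N" by (simp add: inner_add_right)
    with 1 2 have "r * norm g \<le> N - a - v \<bullet> d" by (simp add: algebra_simps)
    then show "norm g \<le> (N - a - v \<bullet> d) / r" using r by (simp add: field_simps)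
  qed
qed

section \<open>The equivalence of the three conditions\<close>

theorem lemma7p9:
  fixes f :: "'a::{real_inner, complete_space} \<Rightarrow> ereal"
  assumes "f \<in> Gamma0"
    and "interior (edom f) \<noteq> {}"
  shows "(at_most_single_valued (subdifferential f)
          \<longleftrightarrow> gateaux_differentiable_on f (interior (edom f)) \<and>
              (\<forall>x. x \<notin> interior (edom f) \<longrightarrow> subdifferential f x = {}))
       \<and> (at_most_single_valued (subdifferential f)
          \<longleftrightarrow> gateaux_differentiable_on f (interior (edom f)) \<and>
              (\<forall>(X :: nat \<Rightarrow> 'a) x.
                 (\<forall>i. X i \<in> interior (edom f)) \<and> x \<in> frontier (interior (edom f)) \<and>
                 X \<longlonglongrightarrow> x \<longrightarrow>
                 filterlim (\<lambda>i. norm (gateaux_gradient f (X i))) at_top sequentially))"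
    (is "(?i \<longleftrightarrow> ?G \<and> ?empty) \<and> (?i \<longleftrightarrow> ?G \<and> ?blowup)")
proof -
  note f = assms(1)
  have pf: "proper_fun f" and lsc: "lower_semicontinuous f" and cv: "convex (edom f)"
    using f by (auto simp: Gamma0_def intro: convex_edom)
  obtain c where c: "c \<in> interior (edom f)" using assms(2) by blast
  have grad: "subdifferential f x = {gateaux_gradient f x}" if ?G "x \<in> interior (edom f)" for x
    using that gateaux_subdifferential[OF f] unfolding gateaux_differentiable_on_def by blast
  have in_dom: "x \<in> edom f" if "v \<in> subdifferential f x" for x v
    by (rule subdifferential_finite[OF pf that]) (simp add: edom_def)
  have "?G" if i: ?i
    unfolding gateaux_differentiable_on_def
  proof
    fix x assume x: "x \<in> interior (edom f)"
    then obtain v where "subdifferential f x = {v}"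
      using i subdifferential_ne_empty_interior[OF f x] unfolding at_most_single_valued_def by blast
    then show "\<exists>L. has_gateaux_derivative f L x" using unique_subgradient_gateaux[OF f x] by blast
  qed
  moreover have "?empty" if i: ?i
  proof (intro allI impI equals0I)
    fix x v assume x: "x \<notin> interior (edom f)" and v: "v \<in> subdifferential f x"
    obtain w where w: "w \<noteq> 0" "\<And>y. y \<in> edom f \<Longrightarrow> w \<bullet> (y - x) \<le> 0"
      using convex_normal_vector[OF cv c in_dom[OF v] x] by metis
    have "v + w \<in> subdifferential f x" by (rule subdifferential_add_normal[OF v w(2)])
    then have "v + w = v" using i v unfolding at_most_single_valued_def by fastforce
    then show False using w(1) by simp
  qed
  moreover have ?i if G: ?G and "?empty"
    using that grad unfolding at_most_single_valued_def by metis
  moreover have "?blowup" if G: ?G and e: ?empty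
  proof (intro allI impI, elim conjE, rule ccontr)
    fix X :: "nat \<Rightarrow> 'a" and x
    assume X: "\<forall>i. X i \<in> interior (edom f)" "X \<longlonglongrightarrow> x" and x: "x \<in> frontier (interior (edom f))"
      and "\<not> filterlim (\<lambda>i. norm (gateaux_gradient f (X i))) at_top sequentially"
    \<comment> \<open>Failure of divergence means norms below some \<open>M\<close> at infinitely
      many indices, which give a subsequence with bounded gradients.\<close>
    then obtain M where "\<exists>\<^sub>F i in sequentially. norm (gateaux_gradient f (X i)) < M"
      by (auto simp: filterlim_at_top not_eventually not_le)
    then have "infinite {i. norm (gateaux_gradient f (X i)) < M}"
      by (simp add: frequently_cofinite flip: cofinite_eq_sequentially)
    then obtain k :: "nat \<Rightarrow> nat" where k: "strict_mono k" "\<And>i. norm (gateaux_gradient f (X (k i))) < M"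
      using infinite_enumerate by blast
    have "subdifferential f x \<noteq> {}"
    proof (rule subdifferential_closed_bounded[OF pf lsc])
      show "(\<lambda>i. X (k i)) \<longlonglongrightarrow> x" using LIMSEQ_subseq_LIMSEQ[OF X(2) k(1)] by (simp add: o_def)
      show "gateaux_gradient f (X (k i)) \<in> subdifferential f (X (k i))" for i
        using grad[OF G] X(1) by simp
      show "norm (gateaux_gradient f (X (k i))) \<le> M" for i using k(2) less_imp_le by blast
    qed
    \<comment> \<open>The interior is open, so its frontier point \<open>x\<close> lies outside it,
      where no subgradient exists.\<close>
    then show False using e x by (simp add: frontier_def)
  qed
  moreover have "?empty" if G: ?G and blowup: ?blowup
  proof (intro allI impI equals0I)
    fix x v assume x: "x \<notin> interior (edom f)" and v: "v \<in> subdifferential f x"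
    obtain M where M: "\<And>s g. 0 < s \<Longrightarrow> s \<le> 1 \<Longrightarrow> g \<in> subdifferential f (s *\<^sub>R c + (1 - s) *\<^sub>R x) \<Longrightarrow> norm g \<le> M"
      using subgradients_bounded_along_segment[OF f c v] by metis
    \<comment> \<open>The points \<open>X i\<close> start at \<open>c\<close> and run along the
      segment towards \<open>x\<close>, staying in the interior; hence \<open>x\<close> is a
      frontier point and the blow-up condition contradicts the bound \<open>M\<close>.\<close>
    define s where "s i = inverse (real (Suc i))" for i
    define X where "X i = s i *\<^sub>R c + (1 - s i) *\<^sub>R x" for i
    have s: "0 < s i" "s i \<le> 1" for i by (auto simp: s_def field_simps)
    have X: "X i \<in> interior (edom f)" for i
      unfolding X_def by (rule convex_interior_combination[OF cv c in_dom[OF v] s])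
    have "s \<longlonglongrightarrow> 0" unfolding s_def by (rule LIMSEQ_inverse_real_of_nat)
    then have "X \<longlonglongrightarrow> 0 *\<^sub>R c + (1 - 0) *\<^sub>R x" unfolding X_def by (intro tendsto_intros)
    then have lim: "X \<longlonglongrightarrow> x" by simp
    then have "x \<in> closure (interior (edom f))" using X unfolding closure_sequential by blast
    then have "x \<in> frontier (interior (edom f))" using x by (simp add: frontier_def)
    then have "filterlim (\<lambda>i. norm (gateaux_gradient f (X i))) at_top sequentially"
      using blowup X lim by blast
    then have "\<forall>\<^sub>F i in sequentially. M + 1 \<le> norm (gateaux_gradient f (X i))"
      by (simp add: filterlim_at_top)
    then obtain i where "M + 1 \<le> norm (gateaux_gradient f (X i))" by (auto simp: eventually_sequentially)
    moreover have "norm (gateaux_gradient f (X i)) \<le> M"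
      using M[OF s, of "gateaux_gradient f (X i)" i] grad[OF G X] by (simp add: X_def)
    ultimately show False by simp
  qed
  ultimately show ?thesis by argo
qed

end
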